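(* If $G$ is a finite group and $V$ is an irreducible representation of $G$ over $\mathbb{C}$, then $\dim V$ divides $|G|$. *)

theory Defs
  imports Complex_Main "HOL-Algebra.Group_Action"
begin

text \<open>
  A representation of \<open>G\<close> on the vector space with underlying type \<open>'v\<close> and scalar
  multiplication \<open>scale\<close> is an action of \<open>G\<close> on all of \<open>'v\<close> by linear maps: \<open>group_action G UNIV \<rho>\<close>
  says that \<open>\<rho>\<close> is a group homomorphism from \<open>G\<close> to the group of bijections of \<open>'v\<close>, so
  together with linearity it is a homomorphism into the general linear group of \<open>'v\<close>.
  No finite-dimensionality is assumed.
\<close>

locale linear_representation =
  group_action G UNIV \<rho> + vector_space scale
  for G :: "('g, 'm) monoid_scheme" (structure)
    and scale :: "'k::field \<Rightarrow> 'v::ab_group_add \<Rightarrow> 'v"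
    and \<rho> :: "'g \<Rightarrow> 'v \<Rightarrow> 'v" +
  assumes linear: "g \<in> carrier G \<Longrightarrow> Vector_Spaces.linear scale scale (\<rho> g)"
begin

definition subrepresentation :: "'v set \<Rightarrow> bool"
  where "subrepresentation W \<longleftrightarrow> subspace W \<and> (\<forall>g \<in> carrier G. \<rho> g ` W \<subseteq> W)"

end

locale irreducible_representation = linear_representation G scale \<rho>
  for G :: "('g, 'm) monoid_scheme" (structure)
    and scale :: "'k::field \<Rightarrow> 'v::ab_group_add \<Rightarrow> 'v"
    and \<rho> :: "'g \<Rightarrow> 'v \<Rightarrow> 'v" +
  assumes nonzero: "(UNIV :: 'v set) \<noteq> {0}"
    and irreducible: "subrepresentation W \<Longrightarrow> W = {0} \<or> W = UNIV"

end

theory Submission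
  imports "Jordan_Normal_Form.Char_Poly" Defs
begin

text \<open>
  Write \<open>n\<close> for the dimension and \<open>c = |G| / n\<close>. The classical argument shows that \<open>c\<close> is an
  algebraic integer by means of characters, class sums and roots of unity. Here a single matrix
  coefficient \<open>f x = \<phi> (\<rho> x v)\<close> takes their place, for a linear form \<open>\<phi>\<close> and a vector \<open>v\<close>.

  For a linear form \<open>\<phi>\<close> and a vector \<open>w\<close>, the operator
  \<open>x \<mapsto> \<Sum>\<^sub>g \<phi> (\<rho> g x) \<rho> (g\<inverse>) w\<close> commutes with the action of \<open>G\<close>, so it is a scalar by Schur's
  lemma. Each of the \<open>|G|\<close> summands has rank at most one and trace \<open>\<phi> w\<close>, hence the scalar
  is \<open>c \<phi> w\<close> (\<open>average_eq\<close>). Applied with \<open>w = v\<close> to the form \<open>\<phi> \<circ> \<rho> x\<close>, and followed by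
  \<open>\<phi> \<circ> \<rho> y\<close>, this gives (\<open>coefficient_product\<close>)
    \<open>c f(x) f(y) = \<Sum>\<^sub>g f(x g) f(y g\<inverse>)\<close>.
  So multiplication by \<open>c\<close> turns each of the finitely many numbers \<open>f(x) f(y)\<close> into a sum of such
  numbers. If \<open>\<phi> v = 1\<close>, they are not all zero, and \<open>c\<close> is an eigenvalue of a matrix with integer
  entries that is indexed by \<open>G \<times> G\<close>. Therefore \<open>c\<close> is an algebraic integer
  (\<open>algebraic_int_if_integer_relations\<close>), and since it is rational, it is an integer.
\<close>

section \<open>Integrality\<close>

text \<open>
  The relations say that the vector of the values of \<open>f\<close> is an eigenvector of the integer matrix
  \<open>a\<close> with eigenvalue \<open>c\<close>, so \<open>c\<close> is a root of its characteristic polynomial, which is monic with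
  integer coefficients.
\<close>

lemma algebraic_int_if_integer_relations:
  fixes c :: "'a::field_char_0" and f :: "'i \<Rightarrow> 'a" and a :: "'i \<Rightarrow> 'i \<Rightarrow> int"
  assumes "finite I" and "i\<^sub>0 \<in> I" and "f i\<^sub>0 \<noteq> 0"
    and rel: "\<And>i. i \<in> I \<Longrightarrow> c * f i = (\<Sum>j\<in>I. of_int (a i j) * f j)"
  shows "algebraic_int c"
proof -
  define n where "n = card I"
  obtain e where e: "bij_betw e {0..<n} I"
    unfolding n_def using \<open>finite I\<close> ex_bij_betw_nat_finite by blast
  define A where "A = Matrix.mat n n (\<lambda>(k, l). a (e k) (e l))"
  define A' :: "'a mat" where "A' = map_mat of_int A"
  define v where "v = Matrix.vec n (\<lambda>k. f (e k))"
  have A: "A \<in> carrier_mat n n" and A': "A' \<in> carrier_mat n n"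
    by (simp_all add: A_def A'_def)
  obtain k\<^sub>0 where k\<^sub>0: "k\<^sub>0 < n" "e k\<^sub>0 = i\<^sub>0"
    using e \<open>i\<^sub>0 \<in> I\<close> by (auto simp: bij_betw_def)
  have "v \<noteq> 0\<^sub>v n"
  proof
    assume "v = 0\<^sub>v n"
    then have "v $ k\<^sub>0 = 0" using k\<^sub>0 by simp
    with k\<^sub>0 \<open>f i\<^sub>0 \<noteq> 0\<close> show False by (simp add: v_def)
  qed
  moreover have "A' *\<^sub>v v = c \<cdot>\<^sub>v v"
  proof (rule eq_vecI)
    fix k assume "k < dim_vec (c \<cdot>\<^sub>v v)"
    then have k: "k < n" by (simp add: v_def)
    then have "(A' *\<^sub>v v) $ k = (\<Sum>l = 0..<n. of_int (a (e k) (e l)) * f (e l))"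
      by (simp add: A'_def A_def v_def scalar_prod_def)
    also have "\<dots> = (\<Sum>j\<in>I. of_int (a (e k) j) * f j)"
      by (rule sum.reindex_bij_betw[OF e])
    also have "\<dots> = c * f (e k)"
      using rel[of "e k"] e k by (auto simp: bij_betw_def)
    finally show "(A' *\<^sub>v v) $ k = (c \<cdot>\<^sub>v v) $ k" using k by (simp add: v_def)
  qed (simp add: A'_def A_def v_def)
  ultimately have "eigenvalue A' c"
    using A' unfolding eigenvalue_def eigenvector_def by (intro exI[of _ v]) (auto simp: v_def)
  then have root: "poly (char_poly A') c = 0"
    using eigenvalue_root_char_poly[OF A'] by simp
  have cp: "char_poly A' = map_poly of_int (char_poly A)"
    unfolding A'_def by (rule of_int_hom.char_poly_hom[OF A])
  show ?thesis
  proof (rule algebraic_int.intros[OF _ _ root])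
    show "lead_coeff (char_poly A') = 1"
      using degree_monic_char_poly[OF A'] by simp
    show "\<forall>i. poly.coeff (char_poly A') i \<in> \<int>"
      by (simp add: cp)
  qed
qed

section \<open>Eigenvectors\<close>

text \<open>
  Write \<open>p = (X - r) q\<close> for a root \<open>r\<close>. Either \<open>v\<close> is already an eigenvector for \<open>r\<close>, or
  \<open>f v - r v\<close> is a nonzero vector annihilated by \<open>q(f)\<close>, and the degree has dropped. The existence
  of roots is a hypothesis because the scalar field of the ambient locale is an arbitrary field.
\<close>

lemma (in vector_space) eigenvector_if_annihilating_poly:
  assumes f: "Vector_Spaces.linear scale scale f"
    and roots: "\<And>p :: 'a poly. degree p > 0 \<Longrightarrow> \<exists>r. poly p r = 0"
    and "p \<noteq> 0" and "v \<noteq> 0"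
    and "(\<Sum>i\<le>degree p. scale (poly.coeff p i) ((f ^^ i) v)) = 0"
  shows "\<exists>r u. u \<noteq> 0 \<and> f u = scale r u"
  using assms(3-)
proof (induction "degree p" arbitrary: p v)
  case 0
  then have "scale (poly.coeff p 0) v = 0" by simp
  moreover have "poly.coeff p 0 \<noteq> 0" using 0 leading_coeff_0_iff by metis
  ultimately show ?case using 0 by simp
next
  case (Suc n)
  interpret f: Vector_Spaces.linear scale scale f by (rule f)
  have fi: "(f ^^ i) (x - y) = (f ^^ i) x - (f ^^ i) y"
    "(f ^^ i) (scale r x) = scale r ((f ^^ i) x)" for i x y r
    by (induction i) (simp_all add: f.diff f.scale)
  obtain r where "poly p r = 0" using roots[of p] Suc.hyps(2) by auto
  then obtain q where p: "p = [:- r, 1:] * q" by (auto simp: poly_eq_0_iff_dvd)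
  have "q \<noteq> 0" using p Suc.prems by auto
  then have "degree p = Suc (degree q)" unfolding p by (subst degree_mult_eq) auto
  then have dq: "degree q = n" using Suc.hyps(2) by simp
  show ?case
  proof (cases "f v - scale r v = 0")
    case True
    then show ?thesis using Suc.prems by auto
  next
    case False
    \<comment> \<open>The goal of the following chain is \<open>q(f) (f v - r v) = p(f) v\<close>; both sums on the left are
      first extended to the range of indices of \<open>p\<close>.\<close>
    have cp: "poly.coeff p i = (case i of 0 \<Rightarrow> 0 | Suc j \<Rightarrow> poly.coeff q j) - r * poly.coeff q i" for i
      by (simp add: p coeff_pCons)
    have "(\<Sum>i\<le>n. scale (poly.coeff q i) ((f ^^ i) (f v - scale r v)))
        = (\<Sum>i\<le>n. scale (poly.coeff q i) ((f ^^ Suc i) v))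
          - (\<Sum>i\<le>n. scale (r * poly.coeff q i) ((f ^^ i) v))"
      by (simp add: fi funpow_swap1 scale_right_diff_distrib sum_subtractf mult.commute)
    also have "(\<Sum>i\<le>n. scale (r * poly.coeff q i) ((f ^^ i) v))
        = (\<Sum>i\<le>Suc n. scale (r * poly.coeff q i) ((f ^^ i) v))"
      using dq by (simp add: coeff_eq_0)
    also have "(\<Sum>i\<le>n. scale (poly.coeff q i) ((f ^^ Suc i) v))
        = (\<Sum>i\<le>Suc n. scale (case i of 0 \<Rightarrow> 0 | Suc j \<Rightarrow> poly.coeff q j) ((f ^^ i) v))"
      by (simp add: sum.atMost_Suc_shift del: sum.atMost_Suc)
    also have "\<dots> - (\<Sum>i\<le>Suc n. scale (r * poly.coeff q i) ((f ^^ i) v))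
        = (\<Sum>i\<le>degree p. scale (poly.coeff p i) ((f ^^ i) v))"
      unfolding cp Suc.hyps(2)[symmetric] by (simp only: scale_left_diff_distrib sum_subtractf)
    also have "\<dots> = 0" by (rule Suc.prems)
    finally show ?thesis
      using Suc.hyps(1)[of q] dq \<open>q \<noteq> 0\<close> False by blast
  qed
qed

text \<open>
  The \<open>n + 1\<close> iterates \<open>v, f v, \<dots>, f\<^sup>n v\<close> satisfy a nontrivial linear relation in dimension \<open>n\<close>.
\<close>

lemma (in finite_dimensional_vector_space) annihilating_poly_exists:
  "\<exists>p :: 'a poly. p \<noteq> 0 \<and> (\<Sum>i\<le>degree p. scale (poly.coeff p i) ((f ^^ i) v)) = 0"
proof -
  let ?g = "\<lambda>i. (f ^^ i) v"
  \<comment> \<open>Linear dependence speaks of sets of vectors, so a repetition among the iterates has to be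
    treated separately. Both cases give a relation indexed by exponents.\<close>
  have *: ?thesis if "finite I" "i \<in> I" "c i \<noteq> 0" "(\<Sum>i\<in>I. scale (c i) (?g i)) = 0"
    for I :: "nat set" and i :: nat and c :: "nat \<Rightarrow> 'a"
  proof -
    define p where "p = (\<Sum>j\<in>I. monom (c j) j)"
    have cp: "poly.coeff p j = (if j \<in> I then c j else 0)" for j
      using \<open>finite I\<close> by (simp add: p_def coeff_sum)
    have "p \<noteq> 0" using cp[of i] that by auto
    moreover have "(\<Sum>j\<le>degree p. scale (poly.coeff p j) (?g j)) = (\<Sum>j\<in>I. scale (c j) (?g j))"
      by (rule sum.mono_neutral_cong) (use \<open>finite I\<close> in \<open>auto simp: cp intro: le_degree\<close>)
    ultimately show ?thesis using that by auto
  qed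
  show ?thesis
  proof (cases "inj_on ?g {..dimension}")
    case False
    then obtain i j where "i \<noteq> j" "?g i = ?g j" by (auto simp: inj_on_def)
    then show ?thesis
      using *[of "{i, j}" i "\<lambda>k. if k = i then 1 else - 1"] by simp
  next
    case True
    then have "card (?g ` {..dimension}) = Suc dimension" by (simp add: card_image)
    then have "dependent (?g ` {..dimension})"
      using independent_card_le_dim[of "?g ` {..dimension}" UNIV] dim_UNIV by (auto simp: dimension_def)
    then obtain u where u: "\<exists>w\<in>?g ` {..dimension}. u w \<noteq> 0"
        "(\<Sum>w\<in>?g ` {..dimension}. scale (u w) w) = 0"
      by (subst (asm) dependent_finite) auto
    then obtain i where "i \<in> {..dimension}" "u (?g i) \<noteq> 0" by auto
    then show ?thesis
      using *[of "{..dimension}" i "\<lambda>i. u (?g i)"] u(2) by (simp add: sum.reindex[OF True])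
  qed
qed

lemma (in finite_dimensional_vector_space) eigenvector_exists:
  fixes f :: "'b \<Rightarrow> 'b" and v :: 'b
  assumes f: "Vector_Spaces.linear scale scale f" and "v \<noteq> 0"
    and roots: "\<And>p :: 'a poly. degree p > 0 \<Longrightarrow> \<exists>r. poly p r = 0"
  shows "\<exists>r u. u \<noteq> 0 \<and> f u = scale r u"
proof -
  obtain p :: "'a poly" where "p \<noteq> 0"
    and "(\<Sum>i\<le>degree p. scale (poly.coeff p i) ((f ^^ i) v)) = 0"
    using annihilating_poly_exists[of f v] by auto
  with f roots \<open>v \<noteq> 0\<close> show ?thesis
    by (intro eigenvector_if_annihilating_poly[of f p v])
qed

section \<open>Averaging rank-one operators over the group\<close>

context linear_representation
begin

lemma apply_one [simp]: "\<rho> \<one> x = x"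
  using id_eq_one by (metis UNIV_I restrict_apply')

lemma apply_mult:
  assumes "g \<in> carrier G" "h \<in> carrier G"
  shows "\<rho> (g \<otimes> h) x = \<rho> g (\<rho> h x)"
  using composition_rule assms by simp

lemma is_group: "group G"
  using group_hom by (simp add: group_hom_def)

text \<open>
  The source of finite-dimensionality: in an irreducible representation of a finite group, the
  finite orbit of a nonzero vector spans the whole space.
\<close>

lemma subrepresentation_span_orbit: "subrepresentation (span ((\<lambda>g. \<rho> g v) ` carrier G))"
  unfolding subrepresentation_def
proof (intro conjI ballI)
  interpret G: group G by (rule is_group)
  fix g assume g: "g \<in> carrier G"
  interpret \<rho>: Vector_Spaces.linear scale scale "\<rho> g" by (rule linear[OF g])
  have "\<rho> g ` (\<lambda>g. \<rho> g v) ` carrier G \<subseteq> (\<lambda>g. \<rho> g v) ` carrier G"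
    using g by (auto simp: image_iff simp flip: apply_mult)
  then show "\<rho> g ` span ((\<lambda>g. \<rho> g v) ` carrier G) \<subseteq> span ((\<lambda>g. \<rho> g v) ` carrier G)"
    by (simp flip: \<rho>.span_image add: span_mono)
qed (rule subspace_span)

text \<open>
  The sum over \<open>G\<close> of the conjugates \<open>\<rho> (g\<inverse>) \<circ> E \<circ> \<rho> g\<close> of the rank-one operator
  \<open>E x = \<phi> x w\<close>. It is not divided by \<open>|G|\<close>: exactly the factor \<open>|G|\<close> has to survive.
\<close>

definition average :: "('v \<Rightarrow> 'k) \<Rightarrow> 'v \<Rightarrow> 'v \<Rightarrow> 'v"
  where "average \<phi> w v = (\<Sum>g\<in>carrier G. scale (\<phi> (\<rho> g v)) (\<rho> (inv g) w))"

lemma linear_average: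
  assumes "Vector_Spaces.linear scale (*) \<phi>"
  shows "Vector_Spaces.linear scale scale (average \<phi> w)"
proof -
  interpret \<phi>: Vector_Spaces.linear scale "(*)" \<phi> by fact
  have "\<phi> (\<rho> g (x + y)) = \<phi> (\<rho> g x) + \<phi> (\<rho> g y)" "\<phi> (\<rho> g (scale r x)) = r * \<phi> (\<rho> g x)"
    if "g \<in> carrier G" for g x y r
  proof -
    interpret \<rho>: Vector_Spaces.linear scale scale "\<rho> g" by (rule linear[OF that])
    show "\<phi> (\<rho> g (x + y)) = \<phi> (\<rho> g x) + \<phi> (\<rho> g y)" "\<phi> (\<rho> g (scale r x)) = r * \<phi> (\<rho> g x)"
      by (simp_all add: \<rho>.add \<rho>.scale \<phi>.add \<phi>.scale)
  qed
  then show ?thesis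
    by unfold_locales
      (simp_all add: average_def scale_left_distrib sum.distrib scale_sum_right cong: sum.cong)
qed

lemma average_commutes:
  assumes h: "h \<in> carrier G"
  shows "average \<phi> w (\<rho> h v) = \<rho> h (average \<phi> w v)"
proof -
  interpret G: group G by (rule is_group)
  interpret \<rho>: Vector_Spaces.linear scale scale "\<rho> h" by (rule linear[OF h])
  \<comment> \<open>Substitute \<open>k = g h\<close>, so that \<open>g\<inverse> = h k\<inverse>\<close>.\<close>
  have "average \<phi> w (\<rho> h v) = (\<Sum>k\<in>carrier G. scale (\<phi> (\<rho> k v)) (\<rho> h (\<rho> (inv k) w)))"
    unfolding average_def
    by (rule sum.reindex_bij_witness[of _ "\<lambda>k. k \<otimes> inv h" "\<lambda>g. g \<otimes> h"])
      (use h in \<open>simp_all add: G.m_assoc G.inv_mult_group flip: apply_mult\<close>,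
        simp add: G.m_assoc[symmetric] flip: apply_mult)
  also have "\<dots> = \<rho> h (average \<phi> w v)"
    by (simp add: average_def \<rho>.sum \<rho>.scale)
  finally show ?thesis .
qed

end

context irreducible_representation
begin

lemma finite_basis_exists:
  assumes "finite (carrier G)"
  obtains B where "finite_dimensional_vector_space scale B"
proof -
  obtain v :: 'v where "v \<noteq> 0" using nonzero by auto
  let ?S = "(\<lambda>g. \<rho> g v) ` carrier G"
  interpret G: group G by (rule is_group)
  have "v \<in> span ?S"
    by (rule span_base) (use apply_one G.one_closed in \<open>metis image_eqI\<close>)
  then have span: "span ?S = UNIV"
    using irreducible[OF subrepresentation_span_orbit] \<open>v \<noteq> 0\<close> by blast
  obtain B where "B \<subseteq> ?S" "independent B" "?S \<subseteq> span B"
    using maximal_independent_subset by blast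
  moreover have "finite B" using \<open>B \<subseteq> ?S\<close> assms finite_subset by blast
  moreover have "span B = UNIV"
    using span span_minimal[OF \<open>?S \<subseteq> span B\<close>] by auto
  ultimately show thesis
    using that by (simp add: finite_dimensional_vector_space_def finite_dimensional_vector_space_axioms_def vector_space_axioms)
qed

text \<open>
  An eigenspace of an intertwining operator is a subrepresentation.
\<close>

lemma schur:
  assumes f: "Vector_Spaces.linear scale scale f"
    and commutes: "\<And>g x. g \<in> carrier G \<Longrightarrow> f (\<rho> g x) = \<rho> g (f x)"
    and u: "u \<noteq> 0" "f u = scale r u"
  shows "f x = scale r x"
proof -
  interpret f: Vector_Spaces.linear scale scale f by (rule f)
  have "subrepresentation {x. f x = scale r x}"
    unfolding subrepresentation_def
  proof (intro conjI ballI)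
    show "subspace {x. f x = scale r x}"
      by (rule subspaceI) (simp_all add: f.add f.scale scale_right_distrib mult.commute)
    fix g assume g: "g \<in> carrier G"
    interpret \<rho>: Vector_Spaces.linear scale scale "\<rho> g" by (rule linear[OF g])
    show "\<rho> g ` {x. f x = scale r x} \<subseteq> {x. f x = scale r x}"
      using commutes[OF g] by (auto simp: \<rho>.scale)
  qed
  from irreducible[OF this] u show ?thesis by blast
qed

end

section \<open>The product formula for matrix coefficients\<close>

text \<open>
  An algebraically closed field provides the eigenvalue for Schur's lemma. Characteristic zero
  permits the division by the dimension and makes the integers a subring of the field.
\<close>

locale finite_irreducible_representation = irreducible_representation G scale \<rho>
  for G :: "('g, 'm) monoid_scheme" (structure)
    and scale :: "'k::{alg_closed_field, field_char_0} \<Rightarrow> 'v::ab_group_add \<Rightarrow> 'v"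
    and \<rho> :: "'g \<Rightarrow> 'v \<Rightarrow> 'v" +
  assumes finite_carrier: "finite (carrier G)"
begin

lemma dim_pos: "dim UNIV > 0"
proof -
  obtain B where "finite_dimensional_vector_space scale B"
    using finite_basis_exists[OF finite_carrier] .
  then interpret finite_dimensional_vector_space scale B .
  show ?thesis using dim_eq_0[of UNIV] nonzero by auto
qed

text \<open>
  The averaged operator is a scalar \<open>r\<close>, and \<open>r\<close> is found by comparing traces. The trace is the
  sum of the diagonal coefficients in a basis: the scalar operator gives \<open>n r\<close>, and each summand
  \<open>x \<mapsto> \<phi> (\<rho> g x) \<rho> (g\<inverse>) w\<close> gives \<open>\<phi> (\<rho> g (\<rho> (g\<inverse>) w)) = \<phi> w\<close>.
\<close>

lemma average_eq:
  assumes \<phi>: "Vector_Spaces.linear scale (*) \<phi>"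
  shows "average \<phi> w v = scale (of_nat (order G) / of_nat (dim UNIV) * \<phi> w) v"
proof -
  interpret \<phi>: Vector_Spaces.linear scale "(*)" \<phi> by fact
  interpret G: group G by (rule is_group)
  obtain B where "finite_dimensional_vector_space scale B"
    using finite_basis_exists[OF finite_carrier] .
  then interpret finite_dimensional_vector_space scale B .
  have lin: "Vector_Spaces.linear scale scale (average \<phi> w)"
    by (rule linear_average[OF \<phi>])
  obtain x :: 'v where "x \<noteq> 0" using nonzero by auto
  have "\<exists>r u. u \<noteq> 0 \<and> average \<phi> w u = scale r u"
    using lin \<open>x \<noteq> 0\<close> by (rule eigenvector_exists) (rule alg_closed_imp_poly_has_root)
  then obtain r u where "u \<noteq> 0" "average \<phi> w u = scale r u" by blast
  have scalar: "average \<phi> w x = scale r x" for x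
    by (rule schur[OF lin _ \<open>u \<noteq> 0\<close> \<open>average \<phi> w u = scale r u\<close>]) (rule average_commutes)
  let ?R = "representation B"
  have R_linear: "Vector_Spaces.linear scale (*) (\<lambda>v. ?R v b)" for b
    using linear_representation[OF independent_Basis span_Basis] .
  have expand: "(\<Sum>b\<in>B. scale (?R y b) b) = y" for y
    by (rule sum_representation_eq[OF independent_Basis])
      (simp_all add: span_Basis finite_Basis)
  have "of_nat (dim UNIV) * r = (\<Sum>b\<in>B. r)"
    using dim_UNIV by (simp add: dimension_def)
  also have "\<dots> = (\<Sum>b\<in>B. ?R (average \<phi> w b) b)"
    using independent_Basis
    by (intro sum.cong) (auto simp: scalar representation_scale span_Basis representation_basis)
  also have "\<dots> = (\<Sum>b\<in>B. \<Sum>g\<in>carrier G. \<phi> (\<rho> g b) * ?R (\<rho> (inv g) w) b)"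
  proof (rule sum.cong[OF refl])
    fix b
    interpret R: Vector_Spaces.linear scale "(*)" "\<lambda>v. ?R v b" by (rule R_linear)
    show "?R (average \<phi> w b) b = (\<Sum>g\<in>carrier G. \<phi> (\<rho> g b) * ?R (\<rho> (inv g) w) b)"
      by (simp add: average_def R.sum R.scale)
  qed
  also have "\<dots> = (\<Sum>g\<in>carrier G. \<Sum>b\<in>B. \<phi> (\<rho> g b) * ?R (\<rho> (inv g) w) b)"
    by (rule sum.swap)
  also have "\<dots> = (\<Sum>g\<in>carrier G. \<phi> w)"
  proof (rule sum.cong[OF refl])
    fix g assume g: "g \<in> carrier G"
    interpret \<rho>: Vector_Spaces.linear scale scale "\<rho> g" by (rule linear[OF g])
    have "(\<Sum>b\<in>B. \<phi> (\<rho> g b) * ?R (\<rho> (inv g) w) b)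
        = \<phi> (\<rho> g (\<Sum>b\<in>B. scale (?R (\<rho> (inv g) w) b) b))"
      by (simp add: \<rho>.sum \<rho>.scale \<phi>.sum \<phi>.scale mult.commute)
    also have "\<dots> = \<phi> w"
      using g by (simp add: expand flip: apply_mult)
    finally show "(\<Sum>b\<in>B. \<phi> (\<rho> g b) * ?R (\<rho> (inv g) w) b) = \<phi> w" .
  qed
  also have "\<dots> = of_nat (order G) * \<phi> w"
    by (simp add: Coset.order_def)
  finally have "r = of_nat (order G) / of_nat (dim UNIV) * \<phi> w"
    using dim_pos by (simp add: field_simps)
  then show ?thesis using scalar by simp
qed

text \<open>
  This is \<open>\<phi> \<circ> \<rho> y\<close> applied to the preceding identity for the form \<open>\<phi> \<circ> \<rho> x\<close>. The point of it
  is that the products of two values of the coefficient \<open>x \<mapsto> \<phi> (\<rho> x v)\<close> reappear on the right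
  with integer multiplicities.
\<close>

lemma coefficient_product:
  assumes \<phi>: "Vector_Spaces.linear scale (*) \<phi>"
    and x: "x \<in> carrier G" and y: "y \<in> carrier G"
  shows "of_nat (order G) / of_nat (dim UNIV) * (\<phi> (\<rho> x v) * \<phi> (\<rho> y v))
    = (\<Sum>g\<in>carrier G. \<phi> (\<rho> (x \<otimes> g) v) * \<phi> (\<rho> (y \<otimes> inv g) v))"
proof -
  interpret \<phi>: Vector_Spaces.linear scale "(*)" \<phi> by fact
  interpret \<rho>: Vector_Spaces.linear scale scale "\<rho> y" by (rule linear[OF y])
  interpret G: group G by (rule is_group)
  have \<phi>x: "Vector_Spaces.linear scale (*) (\<phi> \<circ> \<rho> x)"
    by (rule Vector_Spaces.linear_compose[OF linear[OF x] \<phi>])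
  have "(\<Sum>g\<in>carrier G. \<phi> (\<rho> (x \<otimes> g) v) * \<phi> (\<rho> (y \<otimes> inv g) v))
      = \<phi> (\<rho> y (average (\<phi> \<circ> \<rho> x) v v))"
    using x y by (simp add: average_def \<rho>.sum \<rho>.scale \<phi>.sum \<phi>.scale apply_mult)
  also have "average (\<phi> \<circ> \<rho> x) v v = scale (of_nat (order G) / of_nat (dim UNIV) * \<phi> (\<rho> x v)) v"
    using average_eq[OF \<phi>x, of v v] by (simp only: o_apply)
  also have "\<phi> (\<rho> y \<dots>) = of_nat (order G) / of_nat (dim UNIV) * \<phi> (\<rho> x v) * \<phi> (\<rho> y v)"
    unfolding \<rho>.scale \<phi>.scale ..
  finally show ?thesis by (simp only: mult.assoc)
qed

section \<open>The dimension divides the order\<close>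

lemma algebraic_int_order_div_dim:
  "algebraic_int (of_nat (order G) / of_nat (dim UNIV) :: 'k)"
proof -
  interpret G: group G by (rule is_group)
  obtain B where "finite_dimensional_vector_space scale B"
    using finite_basis_exists[OF finite_carrier] .
  then interpret finite_dimensional_vector_space scale B .
  have "card B > 0" using dim_pos dim_UNIV by (simp add: dimension_def)
  then obtain b where "b \<in> B" by (auto simp: card_gt_0_iff)
  \<comment> \<open>A coordinate form and its basis vector make the coefficient equal to 1 at the neutral
    element, so the family of products is not identically zero.\<close>
  define \<phi> where "\<phi> v = representation B v b" for v
  have \<phi>: "Vector_Spaces.linear scale (*) \<phi>"
    using linear_representation[OF independent_Basis span_Basis] by (simp add: \<phi>_def[abs_def])
  have "\<phi> b = 1"
    using \<open>b \<in> B\<close> independent_Basis by (simp add: \<phi>_def representation_basis)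
  let ?I = "carrier G \<times> carrier G"
  let ?F = "\<lambda>(x, y). \<phi> (\<rho> x b) * \<phi> (\<rho> y b)"
  let ?move = "\<lambda>(x, y) g. (x \<otimes> g, y \<otimes> inv g)"
  let ?a = "\<lambda>i j. int (card {g \<in> carrier G. ?move i g = j})"
  show ?thesis
  proof (rule algebraic_int_if_integer_relations[of ?I "(\<one>, \<one>)" ?F _ ?a])
    show "finite ?I" using finite_carrier by simp
    show "(\<one>, \<one>) \<in> ?I" by simp
    show "?F (\<one>, \<one>) \<noteq> 0" using \<open>\<phi> b = 1\<close> by simp
    fix i assume "i \<in> ?I"
    then obtain x y where i: "i = (x, y)" and xy: "x \<in> carrier G" "y \<in> carrier G" by blast
    \<comment> \<open>The matrix entry at \<open>(i, j)\<close> counts the group elements that move \<open>i\<close> to \<open>j\<close>.\<close>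
    have "(\<Sum>j\<in>?I. of_int (?a i j) * ?F j) = (\<Sum>j\<in>?I. \<Sum>g\<in>{g \<in> carrier G. ?move i g = j}. ?F (?move i g))"
      by (intro sum.cong refl) simp
    also have "\<dots> = (\<Sum>g\<in>carrier G. ?F (?move i g))"
      by (rule sum.group) (use i xy finite_carrier in auto)
    also have "\<dots> = of_nat (order G) / of_nat (dim UNIV) * ?F i"
      using coefficient_product[OF \<phi> xy, of b] by (simp only: i prod.case)
    finally show "of_nat (order G) / of_nat (dim UNIV) * ?F i = (\<Sum>j\<in>?I. of_int (?a i j) * ?F j)"
      by (rule sym)
  qed
qed

theorem dim_dvd_order: "dim UNIV dvd order G"
proof -
  have "(of_nat (order G) / of_nat (dim UNIV) :: 'k) \<in> \<int>"
    by (rule rational_algebraic_int_is_int[OF algebraic_int_order_div_dim]) simp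
  then obtain k :: int where "of_nat (order G) / of_nat (dim UNIV) = (of_int k :: 'k)"
    unfolding Ints_def by blast
  then have "(of_nat (order G) :: 'k) = of_int k * of_nat (dim UNIV)"
    using dim_pos by (simp add: nonzero_divide_eq_eq)
  then have "(of_int (int (order G)) :: 'k) = of_int (k * int (dim UNIV))"
    by simp
  then have "int (order G) = k * int (dim UNIV)" by (simp only: of_int_eq_iff)
  then have "int (dim UNIV) dvd int (order G)" by simp
  then show ?thesis by (simp only: int_dvd_int_iff)
qed

end

theorem theorem6p3:
  fixes G :: "('g, 'm) monoid_scheme"
    and scale :: "complex \<Rightarrow> 'v::ab_group_add \<Rightarrow> 'v"
    and \<rho> :: "'g \<Rightarrow> 'v \<Rightarrow> 'v"
  assumes "finite (carrier G)"
    and "irreducible_representation G scale \<rho>"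
  shows "vector_space.dim scale UNIV dvd order G"
proof -
  interpret irreducible_representation G scale \<rho> by fact
  interpret finite_irreducible_representation G scale \<rho>
    by unfold_locales fact
  show ?thesis by (rule dim_dvd_order)
qed

end
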